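(* Let $\mathcal{D}$ be a domain in $\mathbb{C}^{2n}_*$ and let $\{R(z,\boldsymbol{t})\}_{\boldsymbol{t}\in\mathcal{D}}$ be a normalized holomorphic family of $\mathbb{C}^{m\times m}$-valued generic rational functions, parameterized by the pole and zero loci. Then the family $\{R(z,\boldsymbol{t})\}_{\boldsymbol{t}\in\mathcal{D}}$ is isoprincipal if and only if it is $\mathcal{PZ}$-isosemiresidual.
   Context: $\mathbb{C}_*=\mathbb{C}\setminus\{0\}$; $\mathbb{C}^{2n}_*$ is the set of $\boldsymbol{t}=(t_1,\dots,t_{2n})\in\mathbb{C}^{2n}$ with pairwise distinct coordinates. Simple singular points. Let $R(z)$ be a $\mathbb{C}^{m\times m}$-valued function, holomorphic and invertible in a punctured neighborhood of $t\in\mathbb{C}$. The point $t$ is regular for $R$ if $R$ and $R^{-1}$ are both holomorphic at $t$, and singular otherwise. A singular point $t$ is simple if either $R$ has a simple pole at $t$ and $R^{-1}$ is holomorphic at $t$ (then $t$ is a pole of $R$), or $R^{-1}$ has a simple pole at $t$ and $R$ is holomorphic at $t$ (then $t$ is a zero of $R$). A function has a simple pole at $t$ if it equals $R_t/(z-t)+H(z)$ with $R_t$ a constant matrix (the residue) and $H$ holomorphic at $t$. Generic rational functions. A $\mathbb{C}^{m\times m}$-valued rational function $R$ is generic if $\det R\not\equiv0$, all its singular points in $\mathbb{C}$ are simple, $\infty$ is a regular point ($R$ and $R^{-1}$ holomorphic at $\infty$), and all residues of $R$ and $R^{-1}$ at their poles have rank one. Such $R$ has equally many poles and zeros; order the poles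 as $t_1,\dots,t_n$ and the zeros as $t_{n+1},\dots,t_{2n}$. The pole and zero matrices are $A_{\mathcal P}=\mathrm{diag}(t_1,\dots,t_n)$ and $A_{\mathcal Z}=\mathrm{diag}(t_{n+1},\dots,t_{2n})$. Let $R_k$ be the residue at $t_k$ of $R$ (for $1\le k\le n$), respectively of $R^{-1}$ (for $n+1\le k\le 2n$), and factor $R_k=f_kg_k$ with $f_k\in\mathbb{C}^{m\times1}$, $g_k\in\mathbb{C}^{1\times m}$ (unique up to $f_k\to f_kc$, $g_k\to c^{-1}g_k$, $c\in\mathbb{C}_*$). A matrix $F_{\mathcal P}\in\mathbb{C}^{m\times n}$ with columns $f_1,\dots,f_n$ (resp. $F_{\mathcal Z}$ with columns $f_{n+1},\dots,f_{2n}$) is a left pole (resp. left zero) semiresidual matrix of $R$; a matrix $G_{\mathcal P}\in\mathbb{C}^{n\times m}$ with rows $g_1,\dots,g_n$ (resp. $G_{\mathcal Z}$ with rows $g_{n+1},\dots,g_{2n}$) is a right pole (resp. right zero) semiresidual matrix. "The matrix $F$ is the left zero semiresidual matrix of $R$" means that $F$ arises for some admissible choice of the factorizations (each column is determined up to a nonzero scalar); similarly for the others. Families. Let $\mathcal{D}\subseteq\mathbb{C}^{2n}_*$ be a domain. A normalized holomorphic family of generic rational functions parameterized by the pole and zero loci is a family $\{R(z,\boldsymbol{t})\}_{\boldsymbol{t}\in\mathcal{D}}$ such that: for each $\boldsymbol{t}\in\mathcal{D}$, $R(\cdot,\boldsymbol{t})$ is a generic $\mathbb{C}^{m\times m}$-valued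 rational function with pole and zero matrices $\mathrm{diag}(t_1,\dots,t_n)$ and $\mathrm{diag}(t_{n+1},\dots,t_{2n})$; for each $\boldsymbol{t}^0\in\mathcal{D}$ and each fixed $z\in\mathbb{C}\setminus\{t_1^0,\dots,t_{2n}^0\}$, $R(z,\boldsymbol{t})$ is holomorphic in $\boldsymbol{t}$ in a neighborhood of $\boldsymbol{t}^0$; and $R(\infty,\boldsymbol{t})\equiv I$. The family is $\mathcal{PZ}$-isosemiresidual if there exist constant matrices $F\in\mathbb{C}^{m\times n}$, $G\in\mathbb{C}^{n\times m}$ such that for every $\boldsymbol{t}\in\mathcal{D}$ the matrices $F$ and $G$ are, respectively, the left zero and right pole semiresidual matrices of $R(\cdot,\boldsymbol{t})$. The family is isoprincipal if for each $1\le k\le 2n$ there exists a $\mathbb{C}^{m\times m}$-valued function $E_k(\zeta)$, holomorphic and invertible in $\mathbb{C}_*$ and independent of $\boldsymbol{t}$, such that for every $\boldsymbol{t}\in\mathcal{D}$ there is a $\mathbb{C}^{m\times m}$-valued function $H_k(\cdot,\boldsymbol{t})$, holomorphic and invertible in a neighborhood of $t_k$, with $R(z,\boldsymbol{t})=H_k(z,\boldsymbol{t})E_k(z-t_k)$ in a punctured neighborhood of $t_k$. *)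

theory Defs
  imports "HOL-Analysis.Analysis" "HOL-Computational_Algebra.Polynomial"
begin

(* Matrix functions of one complex variable are total functions complex => complex^'m^'m, so
   their values at singular points are meaningless; every local notion below therefore only
   looks at a punctured neighbourhood.  The inverse function of R is z |-> matrix_inv (R z);
   for rational R with determinant not identically zero it is the true inverse outside a
   finite set. *)

definition mat_holomorphic_on :: "(complex \<Rightarrow> complex^'c^'r) \<Rightarrow> complex set \<Rightarrow> bool" where
  "mat_holomorphic_on f S \<longleftrightarrow> (\<forall>i j. (\<lambda>z. f z $ i $ j) holomorphic_on S)"

definition mat_inverse_fun :: "(complex \<Rightarrow> complex^'m^'m) \<Rightarrow> complex \<Rightarrow> complex^'m^'m" where
  "mat_inverse_fun R = (\<lambda>z. matrix_inv (R z))"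

(* R, given on a punctured neighbourhood of t, extends holomorphically to t *)
definition mat_holomorphic_at :: "(complex \<Rightarrow> complex^'m^'m) \<Rightarrow> complex \<Rightarrow> bool" where
  "mat_holomorphic_at R t \<longleftrightarrow>
     (\<exists>H S. open S \<and> t \<in> S \<and> mat_holomorphic_on H S \<and> (\<forall>z\<in>S - {t}. R z = H z))"

(* R z = A / (z - t) + H z near t, with H holomorphic at t; then A is the residue of R at t.
   A = 0 is not excluded here: poles and zeros below are required to be singular points. *)
definition has_simple_pole_residue ::
    "(complex \<Rightarrow> complex^'m^'m) \<Rightarrow> complex \<Rightarrow> complex^'m^'m \<Rightarrow> bool" where
  "has_simple_pole_residue R t A \<longleftrightarrow>
     (\<exists>H S. open S \<and> t \<in> S \<and> mat_holomorphic_on H S \<and>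
        (\<forall>z\<in>S - {t}. R z = (\<chi> i j. A $ i $ j / (z - t)) + H z))"

definition has_simple_pole :: "(complex \<Rightarrow> complex^'m^'m) \<Rightarrow> complex \<Rightarrow> bool" where
  "has_simple_pole R t \<longleftrightarrow> (\<exists>A. has_simple_pole_residue R t A)"

definition regular_point :: "(complex \<Rightarrow> complex^'m^'m) \<Rightarrow> complex \<Rightarrow> bool" where
  "regular_point R t \<longleftrightarrow> mat_holomorphic_at R t \<and> mat_holomorphic_at (mat_inverse_fun R) t"

definition pole_point :: "(complex \<Rightarrow> complex^'m^'m) \<Rightarrow> complex \<Rightarrow> bool" where
  "pole_point R t \<longleftrightarrow>
     \<not> regular_point R t \<and> has_simple_pole R t \<and> mat_holomorphic_at (mat_inverse_fun R) t"

definition zero_point :: "(complex \<Rightarrow> complex^'m^'m) \<Rightarrow> complex \<Rightarrow> bool" where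
  "zero_point R t \<longleftrightarrow>
     \<not> regular_point R t \<and> has_simple_pole (mat_inverse_fun R) t \<and> mat_holomorphic_at R t"

definition simple_singular_point :: "(complex \<Rightarrow> complex^'m^'m) \<Rightarrow> complex \<Rightarrow> bool" where
  "simple_singular_point R t \<longleftrightarrow> pole_point R t \<or> zero_point R t"

(* Fractions are reduced, so R has its true value at every point that is not a pole of the
   entry in question. *)
definition rational_matrix_function :: "(complex \<Rightarrow> complex^'m^'m) \<Rightarrow> bool" where
  "rational_matrix_function R \<longleftrightarrow>
     (\<forall>i j. \<exists>p q. q \<noteq> 0 \<and> coprime p q \<and>
        (\<forall>z. poly q z \<noteq> 0 \<longrightarrow> R z $ i $ j = poly p z / poly q z))"

(* "det R is not identically zero" is stated with an infinite set because finitely many values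
   R z may be meaningless; regularity at infinity is regularity of w |-> R (1/w) at w = 0. *)
definition generic_rational :: "(complex \<Rightarrow> complex^'m^'m) \<Rightarrow> bool" where
  "generic_rational R \<longleftrightarrow>
     rational_matrix_function R \<and>
     infinite {z. det (R z) \<noteq> 0} \<and>
     (\<forall>t. \<not> regular_point R t \<longrightarrow> simple_singular_point R t) \<and>
     regular_point (\<lambda>w. R (1 / w)) 0 \<and>
     (\<forall>t A. pole_point R t \<and> has_simple_pole_residue R t A \<longrightarrow> rank A = 1) \<and>
     (\<forall>t A. zero_point R t \<and> has_simple_pole_residue (mat_inverse_fun R) t A \<longrightarrow> rank A = 1)"

(* The residue of R at s k is (k-th column of F) * g_k for some row g_k. *)
definition left_semiresidual ::
    "(complex \<Rightarrow> complex^'m^'m) \<Rightarrow> ('n \<Rightarrow> complex) \<Rightarrow> complex^'n^'m \<Rightarrow> bool" where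
  "left_semiresidual R s F \<longleftrightarrow>
     (\<exists>G :: complex^'m^'n. \<forall>k. has_simple_pole_residue R (s k) (\<chi> i j. F $ i $ k * G $ k $ j))"

(* The residue of R at s k is f_k * (k-th row of G) for some column f_k. *)
definition right_semiresidual ::
    "(complex \<Rightarrow> complex^'m^'m) \<Rightarrow> ('n \<Rightarrow> complex) \<Rightarrow> complex^'m^'n \<Rightarrow> bool" where
  "right_semiresidual R s G \<longleftrightarrow>
     (\<exists>F :: complex^'n^'m. \<forall>k. has_simple_pole_residue R (s k) (\<chi> i j. F $ i $ k * G $ k $ j))"

(* A point t of C^(2n) is a vector indexed by 'n + 'n with n = CARD('n): the Inl-coordinates are
   t_1, ..., t_n (poles), the Inr-coordinates are t_(n+1), ..., t_(2n) (zeros). *)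
definition pole_locus :: "complex^('n::finite + 'n) \<Rightarrow> 'n \<Rightarrow> complex" where
  "pole_locus t k = t $ Inl k"

definition zero_locus :: "complex^('n::finite + 'n) \<Rightarrow> 'n \<Rightarrow> complex" where
  "zero_locus t k = t $ Inr k"

definition distinct_coords :: "(complex^'k) set" where
  "distinct_coords = {t. inj (\<lambda>k. t $ k)}"

definition complex_domain :: "(complex^'k) set \<Rightarrow> bool" where
  "complex_domain D \<longleftrightarrow> open D \<and> connected D \<and> D \<noteq> {}"

(* Holomorphy in several variables: a complex-linear Frechet derivative exists at every point. *)
definition holomorphic_on_several :: "(complex^'k \<Rightarrow> complex) \<Rightarrow> (complex^'k) set \<Rightarrow> bool" where
  "holomorphic_on_several f U \<longleftrightarrow>
     (\<forall>t\<in>U. \<exists>f'. (f has_derivative f') (at t) \<and> (\<forall>c v. f' (c *s v) = c * f' v))"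

definition normalized_holomorphic_family ::
    "(complex^('n::finite + 'n)) set \<Rightarrow> (complex \<Rightarrow> complex^('n + 'n) \<Rightarrow> complex^'m^'m) \<Rightarrow> bool" where
  "normalized_holomorphic_family D R \<longleftrightarrow>
     (\<forall>t\<in>D. generic_rational (\<lambda>z. R z t) \<and>
            bij_betw (pole_locus t) UNIV {z. pole_point (\<lambda>z. R z t) z} \<and>
            bij_betw (zero_locus t) UNIV {z. zero_point (\<lambda>z. R z t) z}) \<and>
     (\<forall>t0\<in>D. \<forall>z. (\<forall>k. z \<noteq> t0 $ k) \<longrightarrow>
        (\<exists>U. open U \<and> t0 \<in> U \<and> U \<subseteq> D \<and>
             (\<forall>i j. holomorphic_on_several (\<lambda>t. R z t $ i $ j) U))) \<and>
     (\<forall>t\<in>D. ((\<lambda>z. R z t) \<longlongrightarrow> mat 1) at_infinity)"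

definition PZ_isosemiresidual ::
    "(complex^('n::finite + 'n)) set \<Rightarrow> (complex \<Rightarrow> complex^('n + 'n) \<Rightarrow> complex^'m^'m) \<Rightarrow> bool" where
  "PZ_isosemiresidual D R \<longleftrightarrow>
     (\<exists>(F :: complex^'n^'m) (G :: complex^'m^'n). \<forall>t\<in>D.
        left_semiresidual (mat_inverse_fun (\<lambda>z. R z t)) (zero_locus t) F \<and>
        right_semiresidual (\<lambda>z. R z t) (pole_locus t) G)"

definition isoprincipal ::
    "(complex^('n::finite + 'n)) set \<Rightarrow> (complex \<Rightarrow> complex^('n + 'n) \<Rightarrow> complex^'m^'m) \<Rightarrow> bool" where
  "isoprincipal D R \<longleftrightarrow>
     (\<forall>k. \<exists>E :: complex \<Rightarrow> complex^'m^'m. mat_holomorphic_on E (- {0}) \<and> (\<forall>\<zeta>. \<zeta> \<noteq> 0 \<longrightarrow> invertible (E \<zeta>)) \<and>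
        (\<forall>t\<in>D. \<exists>(H :: complex \<Rightarrow> complex^'m^'m) S. open S \<and> t $ k \<in> S \<and> mat_holomorphic_on H S \<and>
           (\<forall>z\<in>S. invertible (H z)) \<and>
           (\<forall>z\<in>S - {t $ k}. R z t = H z ** E (z - t $ k))))"

end

theory Submission
  imports Defs
begin

text \<open>
  Both conditions are local: each singular point can be treated separately, and it suffices to
  compare, at every pole and zero, a factorization of the family with the shape of a residue.

  At a pole \<open>t\<close> write the residue of \<open>X = R\<close> as \<open>f g\<close> (a column times a row) and choose a column \<open>h\<close>
  with \<open>g h = 1\<close>, so that \<open>P = h g\<close> is a projection determined by \<open>g\<close> up to the choice of \<open>h\<close>.
  The model singularity is the elementary factor \<open>E(\<zeta>) = (I - P) + \<zeta>\<^sup>-\<^sup>1 P\<close>, with inverse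
  \<open>(I - P) + \<zeta> P\<close>. The quotient \<open>X(z) E(z - t)\<^sup>-\<^sup>1\<close> has no pole because \<open>f g (I - P) = 0\<close>. Its
  inverse \<open>E(z - t) X(z)\<^sup>-\<^sup>1\<close> has no pole either: if \<open>X = f g / (z - t) + H\<close>, then multiplying by
  \<open>X\<^sup>-\<^sup>1\<close> gives \<open>f g X\<^sup>-\<^sup>1 / (z - t) = I - H X\<^sup>-\<^sup>1\<close>, which is holomorphic, and so \<open>P X\<^sup>-\<^sup>1 / (z - t)\<close> is
  holomorphic. Hence \<open>R = H E\<close> with \<open>H\<close> holomorphic and invertible at \<open>t\<close>, and \<open>E\<close> depends on
  nothing but \<open>g\<close> and \<open>h\<close> (lemma \<open>factorization_at_pole\<close>). At a zero the same argument applies to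
  the residue \<open>f g\<close> of \<open>R\<^sup>-\<^sup>1\<close>, with \<open>P = f l\<close>, \<open>l f = 1\<close> and \<open>E(\<zeta>) = (I - P) + \<zeta> P\<close>
  (lemma \<open>factorization_at_zero\<close>). Thus constant semiresidual matrices give an isoprincipal family.

  Conversely, the residue of \<open>X\<close> at a simple pole has the form \<open>f' g\<close> exactly when \<open>X (I - h g)\<close>
  is holomorphic there. This condition is unchanged when \<open>X\<close> is multiplied from the left by a
  holomorphic invertible factor, so it is a property of the function \<open>E\<close> in \<open>R = H E\<close>. If \<open>E\<close> does
  not depend on the parameter, a row \<open>g\<close> obtained at one parameter value serves for all of them
  (lemma \<open>residue_row_transfer\<close>). For the zeros, \<open>R\<^sup>-\<^sup>1 = E\<^sup>-\<^sup>1 H\<^sup>-\<^sup>1\<close> and the roles of rows and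
  columns are exchanged (lemma \<open>residue_column_transfer\<close>).

  Two technical facts support this. A rational matrix function whose determinant is nonzero at
  infinitely many points is invertible outside a finite set, so that \<open>matrix_inv\<close> yields the true
  inverse on every small punctured disc; and by Cramer's rule the inverse of a holomorphic
  invertible matrix function is holomorphic.
\<close>

section \<open>Rank one matrices and inverse matrices\<close>

definition outer :: "'a::comm_semiring_1^'r \<Rightarrow> 'a^'c \<Rightarrow> 'a^'c^'r" where
  "outer f g = (\<chi> i j. f $ i * g $ j)"

definition scale_mat :: "'a::comm_semiring_1 \<Rightarrow> 'a^'c^'r \<Rightarrow> 'a^'c^'r" where
  "scale_mat c A = (\<chi> i j. c * A $ i $ j)"

lemma matrix_add_rdistrib: "(B + C) ** A = B ** A + C ** A" for A :: "'a::comm_ring_1^'n^'m"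
  by (simp add: vec_eq_iff matrix_matrix_mult_def distrib_right sum.distrib)

lemma matrix_diff_ldistrib: "A ** (B - C) = A ** B - A ** C" for A :: "'a::comm_ring_1^'n^'m"
  by (simp add: vec_eq_iff matrix_matrix_mult_def right_diff_distrib sum_subtractf)

lemma matrix_diff_rdistrib: "(B - C) ** A = B ** A - C ** A" for A :: "'a::comm_ring_1^'n^'m"
  by (simp add: vec_eq_iff matrix_matrix_mult_def left_diff_distrib sum_subtractf)

lemma scale_mat_mult_left: "scale_mat c A ** B = scale_mat c (A ** B)"
  by (simp add: vec_eq_iff matrix_matrix_mult_def scale_mat_def sum_distrib_left mult_ac)

lemma scale_mat_mult_right: "A ** scale_mat c B = scale_mat c (A ** B)"
  by (simp add: vec_eq_iff matrix_matrix_mult_def scale_mat_def sum_distrib_left mult_ac)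

lemma scale_mat_scale_mat: "scale_mat c (scale_mat d A) = scale_mat (c * d) A"
  by (simp add: vec_eq_iff scale_mat_def mult_ac)

lemma scale_mat_one [simp]: "scale_mat 1 A = A"
  by (simp add: vec_eq_iff scale_mat_def)

lemma scale_mat_zero [simp]: "scale_mat c 0 = 0"
  by (simp add: vec_eq_iff scale_mat_def)

lemma matrix_mult_outer: "A ** outer h g = outer (A *v h) g"
  by (simp add: vec_eq_iff matrix_matrix_mult_def matrix_vector_mult_def outer_def
      sum_distrib_left mult_ac)

lemma outer_mult_matrix: "outer f l ** A = outer f (l v* A)"
  by (simp add: vec_eq_iff matrix_matrix_mult_def vector_matrix_mult_def outer_def
      sum_distrib_left mult_ac)

lemma outer_mult_outer:
  assumes "(\<Sum>i\<in>UNIV. g $ i * h $ i) = 1"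
  shows "outer f g ** outer h k = outer f k"
proof -
  have "(\<Sum>i\<in>UNIV. f $ a * g $ i * (h $ i * k $ b)) = f $ a * k $ b" for a b
  proof -
    have "(\<Sum>i\<in>UNIV. f $ a * g $ i * (h $ i * k $ b))
        = f $ a * (\<Sum>i\<in>UNIV. g $ i * h $ i) * k $ b"
      by (simp add: sum_distrib_left sum_distrib_right mult_ac)
    then show ?thesis using assms by simp
  qed
  then show ?thesis by (simp add: vec_eq_iff matrix_matrix_mult_def outer_def)
qed

lemma outer_zero [simp]: "outer 0 g = 0" "outer f 0 = 0"
  by (simp_all add: vec_eq_iff outer_def)

lemma exists_dual_vector:
  fixes g :: "'a::field^'n"
  assumes "g \<noteq> 0"
  obtains h where "(\<Sum>i\<in>UNIV. g $ i * h $ i) = 1" "(\<Sum>i\<in>UNIV. h $ i * g $ i) = 1"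
proof -
  obtain i where i: "g $ i \<noteq> 0" using assms by (auto simp: vec_eq_iff)
  have "(\<Sum>j\<in>UNIV. g $ j * (axis i (1 / g $ i)) $ j) = 1"
    using i by (simp add: axis_def if_distrib [of "\<lambda>x. _ * x"] cong: if_cong)
  then show thesis by (intro that[of "axis i (1 / g $ i)"]) (simp_all add: mult.commute)
qed

lemma rank_one_imp_nonzero:
  fixes A :: "'a::field^'n^'m"
  assumes "rank A = 1"
  shows "A \<noteq> 0"
proof
  assume "A = 0"
  then have "rows A \<subseteq> {0}" by (auto simp: rows_def row_def vec_eq_iff)
  then have "vec.dim (rows A) = 0" by (simp add: vec.dim_eq_0)
  with assms show False unfolding row_rank_def_gen by linarith
qed

text \<open>The span of the rows is a line; \<open>g\<close> is a vector spanning it and \<open>f\<close> collects the coordinates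
  of the rows with respect to \<open>g\<close>.\<close>

lemma rank_one_imp_outer:
  fixes A :: "'a::field^'n^'m"
  assumes "rank A = 1"
  obtains f g where "f \<noteq> 0" "g \<noteq> 0" "A = outer f g"
proof -
  obtain B where B: "B \<subseteq> rows A" "rows A \<subseteq> vec.span B" "card B = vec.dim (rows A)"
    using vec.basis_exists[of "rows A"] by metis
  then have "card B = 1" using assms by (simp add: row_rank_def_gen)
  then obtain b where b: "B = {b}" by (auto simp: card_1_singleton_iff)
  have "\<exists>c. row i A = c *s b" for i
    using B(2) unfolding b vec.span_singleton rows_def by auto
  then obtain c where c: "\<And>i. row i A = c i *s b" by metis
  have A: "A = outer (\<chi> i. c i) b"
    using c by (simp add: vec_eq_iff outer_def row_def)
  moreover have "A \<noteq> 0" using rank_one_imp_nonzero[OF assms] .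
  ultimately show thesis using that by (metis outer_zero)
qed

lemma matrix_inv_cancel:
  fixes A :: "'a::field^'n^'n"
  assumes "invertible A"
  shows "A ** matrix_inv A = mat 1" "matrix_inv A ** A = mat 1"
proof -
  have "\<exists>B. A ** B = mat 1 \<and> B ** A = mat 1" using assms by (simp add: invertible_def)
  from someI_ex[OF this] show "A ** matrix_inv A = mat 1" "matrix_inv A ** A = mat 1"
    by (simp_all add: matrix_inv_def)
qed

text \<open>Column \<open>j\<close> of the inverse solves \<open>A x = e\<^sub>j\<close>. The determinantal form of the solution makes
  the entries of the inverse visibly holomorphic in those of the matrix.\<close>

lemma matrix_inv_cramer:
  fixes A :: "'a::field^'n^'n"
  assumes "invertible A"
  shows "matrix_inv A $ i $ j = det (\<chi> r c. if c = i then mat 1 $ r $ j else A $ r $ c) / det A"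
proof -
  let ?x = "\<chi> i. matrix_inv A $ i $ j"
  have "A *v ?x = (\<chi> r. (A ** matrix_inv A) $ r $ j)"
    by (simp add: vec_eq_iff matrix_vector_mult_def matrix_matrix_mult_def)
  then have Ax: "A *v ?x = (\<chi> r. mat 1 $ r $ j)"
    by (simp add: matrix_inv_cancel[OF assms])
  have "det A \<noteq> 0" using assms by (simp add: invertible_det_nz)
  from iffD1[OF cramer[OF this] Ax, THEN arg_cong, of "\<lambda>x. x $ i"]
  show ?thesis by (simp cong: if_cong)
qed

section \<open>Holomorphic matrix functions\<close>

lemma mat_holomorphic_on_subset: "mat_holomorphic_on f S \<Longrightarrow> T \<subseteq> S \<Longrightarrow> mat_holomorphic_on f T"
  unfolding mat_holomorphic_on_def using holomorphic_on_subset by blast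

lemma mat_holomorphic_on_det:
  assumes "mat_holomorphic_on A S"
  shows "(\<lambda>z. det (A z)) holomorphic_on S"
  using assms unfolding det_def mat_holomorphic_on_def
  by (intro holomorphic_on_sum holomorphic_on_mult holomorphic_on_prod holomorphic_on_const) auto

lemma mat_holomorphic_on_matrix_inv:
  fixes A :: "complex \<Rightarrow> complex^'m^'m"
  assumes A: "mat_holomorphic_on A S" and inv: "\<And>z. z \<in> S \<Longrightarrow> invertible (A z)"
  shows "mat_holomorphic_on (\<lambda>z. matrix_inv (A z)) S"
  unfolding mat_holomorphic_on_def
proof (intro allI)
  fix i j
  let ?M = "\<lambda>z. (\<chi> r c. if c = i then mat 1 $ r $ j else A z $ r $ c) :: complex^'m^'m"
  have "mat_holomorphic_on ?M S"
    unfolding mat_holomorphic_on_def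
  proof (intro allI)
    fix r c
    show "(\<lambda>z. ?M z $ r $ c) holomorphic_on S"
      using A by (cases "c = i") (simp_all add: mat_holomorphic_on_def)
  qed
  then have "(\<lambda>z. det (?M z) / det (A z)) holomorphic_on S"
    using A inv
    by (intro holomorphic_on_divide mat_holomorphic_on_det) (auto simp: invertible_det_nz)
  then show "(\<lambda>z. matrix_inv (A z) $ i $ j) holomorphic_on S"
    by (rule holomorphic_transform) (simp add: matrix_inv_cramer inv)
qed

lemma mat_holomorphic_on_mult:
  assumes "mat_holomorphic_on A S" "mat_holomorphic_on B S"
  shows "mat_holomorphic_on (\<lambda>z. A z ** B z) S"
  using assms unfolding mat_holomorphic_on_def matrix_matrix_mult_def
  by (auto intro!: holomorphic_intros)

lemma mat_holomorphic_on_scale: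
  assumes "c holomorphic_on S" "mat_holomorphic_on A S"
  shows "mat_holomorphic_on (\<lambda>z. scale_mat (c z) (A z)) S"
  using assms unfolding mat_holomorphic_on_def scale_mat_def
  by (auto intro!: holomorphic_intros)

lemma mat_holomorphic_on_add:
  assumes "mat_holomorphic_on A S" "mat_holomorphic_on B S"
  shows "mat_holomorphic_on (\<lambda>z. A z + B z) S"
  using assms unfolding mat_holomorphic_on_def by (auto intro!: holomorphic_intros)

lemma mat_holomorphic_on_diff:
  assumes "mat_holomorphic_on A S" "mat_holomorphic_on B S"
  shows "mat_holomorphic_on (\<lambda>z. A z - B z) S"
  using assms unfolding mat_holomorphic_on_def by (auto intro!: holomorphic_intros)

lemma mat_holomorphic_on_const: "mat_holomorphic_on (\<lambda>z. A) S"
  unfolding mat_holomorphic_on_def by auto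

section \<open>Removable singularities of matrix functions\<close>

lemma mat_holomorphic_atE:
  assumes "mat_holomorphic_at A t"
  obtains H S where "open S" "t \<in> S" "mat_holomorphic_on H S" "\<And>z. z \<in> S \<Longrightarrow> z \<noteq> t \<Longrightarrow> A z = H z"
  using assms unfolding mat_holomorphic_at_def by blast

lemma mat_holomorphic_at_cong:
  assumes A: "mat_holomorphic_at A t" and eq: "\<forall>\<^sub>F z in at t. A z = B z"
  shows "mat_holomorphic_at B t"
proof -
  obtain H S where H: "open S" "t \<in> S" "mat_holomorphic_on H S"
    "\<And>z. z \<in> S \<Longrightarrow> z \<noteq> t \<Longrightarrow> A z = H z"
    by (rule mat_holomorphic_atE[OF A], rule that)
  obtain T where T: "open T" "t \<in> T" "\<forall>z\<in>T. z \<noteq> t \<longrightarrow> A z = B z"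
    using eq unfolding eventually_at_topological by auto
  have "mat_holomorphic_on H (S \<inter> T)" using H(3) by (rule mat_holomorphic_on_subset) auto
  moreover have "\<forall>z\<in>S \<inter> T - {t}. B z = H z" using H(4) T(3) by (metis DiffE IntE insertI1)
  ultimately show ?thesis
    unfolding mat_holomorphic_at_def using H(1,2) T(1,2)
    by (intro exI[of _ H] exI[of _ "S \<inter> T"]) auto
qed

lemma mat_holomorphic_on_imp_at:
  "mat_holomorphic_on A S \<Longrightarrow> open S \<Longrightarrow> t \<in> S \<Longrightarrow> mat_holomorphic_at A t"
  unfolding mat_holomorphic_at_def by blast

lemma mat_holomorphic_at_const: "mat_holomorphic_at (\<lambda>z. A) t"
  by (rule mat_holomorphic_on_imp_at[OF mat_holomorphic_on_const, of UNIV]) auto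

text \<open>Sums, differences and products extend over \<open>t\<close> for the same reason: apply the operation to
  the two extensions on the common part of their domains.\<close>

lemma mat_holomorphic_at_binary:
  assumes A: "mat_holomorphic_at A t" and B: "mat_holomorphic_at B t"
    and op: "\<And>H K S. mat_holomorphic_on H S \<Longrightarrow> mat_holomorphic_on K S \<Longrightarrow>
      mat_holomorphic_on (\<lambda>z. op (H z) (K z)) S"
  shows "mat_holomorphic_at (\<lambda>z. op (A z) (B z)) t"
proof -
  obtain H S where H: "open S" "t \<in> S" "mat_holomorphic_on H S"
    "\<And>z. z \<in> S \<Longrightarrow> z \<noteq> t \<Longrightarrow> A z = H z"
    by (rule mat_holomorphic_atE[OF A], rule that)
  obtain K T where K: "open T" "t \<in> T" "mat_holomorphic_on K T"
    "\<And>z. z \<in> T \<Longrightarrow> z \<noteq> t \<Longrightarrow> B z = K z"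
    by (rule mat_holomorphic_atE[OF B], rule that)
  have "mat_holomorphic_on (\<lambda>z. op (H z) (K z)) (S \<inter> T)"
    by (rule op) (use H(3) K(3) mat_holomorphic_on_subset in blast)+
  then show ?thesis
    unfolding mat_holomorphic_at_def using H(1,2,4) K(1,2,4)
    by (intro exI[of _ "\<lambda>z. op (H z) (K z)"] exI[of _ "S \<inter> T"]) auto
qed

lemma mat_holomorphic_at_mult:
  assumes "mat_holomorphic_at A t" "mat_holomorphic_at B t"
  shows "mat_holomorphic_at (\<lambda>z. A z ** B z) t"
  using assms mat_holomorphic_on_mult by (rule mat_holomorphic_at_binary)

lemma mat_holomorphic_at_add:
  assumes "mat_holomorphic_at A t" "mat_holomorphic_at B t"
  shows "mat_holomorphic_at (\<lambda>z. A z + B z) t"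
  using assms mat_holomorphic_on_add by (rule mat_holomorphic_at_binary)

lemma mat_holomorphic_at_diff:
  assumes "mat_holomorphic_at A t" "mat_holomorphic_at B t"
  shows "mat_holomorphic_at (\<lambda>z. A z - B z) t"
  using assms mat_holomorphic_on_diff by (rule mat_holomorphic_at_binary)

lemma mat_holomorphic_at_shift:
  assumes "mat_holomorphic_at A t"
  shows "mat_holomorphic_at (\<lambda>z. A (z + (t - s))) s"
proof -
  obtain H S where H: "open S" "t \<in> S" "mat_holomorphic_on H S"
    "\<And>z. z \<in> S \<Longrightarrow> z \<noteq> t \<Longrightarrow> A z = H z"
    by (rule mat_holomorphic_atE[OF assms], rule that)
  let ?T = "(\<lambda>z. z + (t - s)) -` S"
  have "open ?T" using H(1) by (intro open_vimage continuous_intros)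
  moreover have "mat_holomorphic_on (\<lambda>z. H (z + (t - s))) ?T"
    unfolding mat_holomorphic_on_def
  proof (intro allI)
    fix i j
    have "(\<lambda>z. H z $ i $ j) holomorphic_on S"
      using H(3) by (simp add: mat_holomorphic_on_def)
    then have "((\<lambda>z. H z $ i $ j) \<circ> (\<lambda>z. z + (t - s))) holomorphic_on ?T"
      by (intro holomorphic_on_compose_gen[of _ _ _ S] holomorphic_intros) auto
    then show "(\<lambda>z. H (z + (t - s)) $ i $ j) holomorphic_on ?T" by (simp add: o_def)
  qed
  ultimately show ?thesis
    unfolding mat_holomorphic_at_def using H(2,4)
    by (intro exI[of _ "\<lambda>z. H (z + (t - s))"] exI[of _ ?T]) (auto simp: algebra_simps)
qed

lemma mat_holomorphic_on_tendsto:
  assumes "mat_holomorphic_on H S" "open S" "t \<in> S"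
  shows "((\<lambda>z. H z $ i $ j) \<longlongrightarrow> H t $ i $ j) (at t)"
proof -
  have "continuous_on S (\<lambda>z. H z $ i $ j)"
    using assms(1) by (simp add: mat_holomorphic_on_def holomorphic_on_imp_continuous_on)
  then show ?thesis using assms(2,3) by (simp add: continuous_on_eq_continuous_at isCont_def)
qed

text \<open>A germ that is invertible among the matrix germs with removable singularity at \<open>t\<close> is invertible
  at \<open>t\<close> itself: the identity \<open>U V = I\<close> passes to the limit by continuity of the extensions. This
  is how the holomorphic invertible factor of a local factorization is recognised.\<close>

lemma mat_holomorphic_at_unit:
  assumes U: "mat_holomorphic_at U t" and V: "mat_holomorphic_at V t"
    and UV: "\<forall>\<^sub>F z in at t. U z ** V z = mat 1"
  obtains H S where "open S" "t \<in> S" "mat_holomorphic_on H S" "\<And>z. z \<in> S \<Longrightarrow> invertible (H z)"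
    "\<And>z. z \<in> S \<Longrightarrow> z \<noteq> t \<Longrightarrow> U z = H z"
proof -
  obtain H S where H: "open S" "t \<in> S" "mat_holomorphic_on H S"
    "\<And>z. z \<in> S \<Longrightarrow> z \<noteq> t \<Longrightarrow> U z = H z"
    by (rule mat_holomorphic_atE[OF U], rule that)
  obtain K T where K: "open T" "t \<in> T" "mat_holomorphic_on K T"
    "\<And>z. z \<in> T \<Longrightarrow> z \<noteq> t \<Longrightarrow> V z = K z"
    by (rule mat_holomorphic_atE[OF V], rule that)
  obtain W where W: "open W" "t \<in> W" "\<And>z. z \<in> W \<Longrightarrow> z \<noteq> t \<Longrightarrow> U z ** V z = mat 1"
    using UV unfolding eventually_at_topological by auto
  let ?S = "S \<inter> T \<inter> W"
  have S: "open ?S" "t \<in> ?S" using H K W by auto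
  have off: "H z ** K z = mat 1" if "z \<in> ?S" "z \<noteq> t" for z
    using that H(4)[of z] K(4)[of z] W(3)[of z] by auto
  have "mat_holomorphic_on (\<lambda>z. H z ** K z) ?S"
    by (intro mat_holomorphic_on_mult mat_holomorphic_on_subset[OF H(3)]
        mat_holomorphic_on_subset[OF K(3)]) auto
  note lim = mat_holomorphic_on_tendsto[OF this S]
  have ev: "\<forall>\<^sub>F z in at t. H z ** K z = mat 1"
    unfolding eventually_at_topological using S off by blast
  have "(H t ** K t) $ i $ j = mat 1 $ i $ j" for i j
  proof (rule tendsto_unique[OF _ lim])
    show "((\<lambda>z. (H z ** K z) $ i $ j) \<longlongrightarrow> mat 1 $ i $ j) (at t)"
      by (rule tendsto_eventually) (use ev in eventually_elim, simp)
  qed simp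
  then have "H t ** K t = mat 1" by (simp add: vec_eq_iff)
  with off have "H z ** K z = mat 1" if "z \<in> ?S" for z using that by metis
  then have "invertible (H z)" if "z \<in> ?S" for z
    using that invertible_right_inverse by blast
  moreover have "mat_holomorphic_on H ?S"
    using H(3) by (rule mat_holomorphic_on_subset) auto
  ultimately show thesis using that[OF S] H(4) by blast
qed

section \<open>Simple poles\<close>

lemma has_simple_pole_residue_iff:
  "has_simple_pole_residue R t A \<longleftrightarrow> mat_holomorphic_at (\<lambda>z. R z - scale_mat (1 / (z - t)) A) t"
proof -
  have *: "(\<chi> i j. A $ i $ j / (z - t)) = scale_mat (1 / (z - t)) A" for z
    by (simp add: scale_mat_def vec_eq_iff)
  show ?thesis
    unfolding has_simple_pole_residue_def mat_holomorphic_at_def * 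
    by (simp add: diff_eq_eq add.commute)
qed

text \<open>Uniqueness of the principal part: multiplying by \<open>z - t\<close> and letting \<open>z\<close> tend to \<open>t\<close> turns
  the left-hand side into \<open>B\<close> and the holomorphic right-hand side into \<open>0\<close>.\<close>

lemma mat_holomorphic_at_principal_part_zero:
  assumes "mat_holomorphic_at (\<lambda>z. scale_mat (1 / (z - t)) B) t"
  shows "B = 0"
proof -
  obtain H S where H: "open S" "t \<in> S" "mat_holomorphic_on H S"
    "\<And>z. z \<in> S \<Longrightarrow> z \<noteq> t \<Longrightarrow> scale_mat (1 / (z - t)) B = H z"
    by (rule mat_holomorphic_atE[OF assms], rule that)
  have "B $ i $ j = 0" for i j
  proof (rule tendsto_unique)
    have "((\<lambda>z. (z - t) * H z $ i $ j) \<longlongrightarrow> (t - t) * H t $ i $ j) (at t)"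
      by (intro tendsto_intros mat_holomorphic_on_tendsto[OF H(3,1,2)])
    then show "((\<lambda>z. (z - t) * H z $ i $ j) \<longlongrightarrow> 0) (at t)" by simp
    have "\<forall>\<^sub>F z in at t. (z - t) * H z $ i $ j = B $ i $ j"
      unfolding eventually_at_topological
      using H(1,2) by (intro exI[of _ S]) (auto simp: H(4)[symmetric] scale_mat_def)
    then show "((\<lambda>z. (z - t) * H z $ i $ j) \<longlongrightarrow> B $ i $ j) (at t)"
      by (rule tendsto_eventually)
  qed simp
  then show ?thesis by (simp add: vec_eq_iff)
qed

text \<open>With \<open>M = I - h g\<close> and \<open>g h = 1\<close> the right-hand side says that the residue is \<open>(A h) g\<close>. The
  shape of the residue is thereby expressed through holomorphy alone, which survives
  multiplication of \<open>X\<close> from the left by a holomorphic factor.\<close>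

lemma simple_pole_mult_right_iff:
  assumes "has_simple_pole_residue X t A"
  shows "mat_holomorphic_at (\<lambda>z. X z ** M) t \<longleftrightarrow> A ** M = 0"
proof -
  let ?K = "\<lambda>z. X z - scale_mat (1 / (z - t)) A"
  have K: "mat_holomorphic_at (\<lambda>z. ?K z ** M) t"
    using assms by (intro mat_holomorphic_at_mult mat_holomorphic_at_const)
      (simp add: has_simple_pole_residue_iff)
  have eq: "?K z ** M = X z ** M - scale_mat (1 / (z - t)) (A ** M)" for z
    by (simp add: matrix_diff_rdistrib scale_mat_mult_left)
  show ?thesis
  proof
    assume "mat_holomorphic_at (\<lambda>z. X z ** M) t"
    from mat_holomorphic_at_diff[OF this K]
    have "mat_holomorphic_at (\<lambda>z. scale_mat (1 / (z - t)) (A ** M)) t" unfolding eq by simp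
    then show "A ** M = 0" by (rule mat_holomorphic_at_principal_part_zero)
  qed (use K[unfolded eq] in simp)
qed

lemma simple_pole_mult_left_iff:
  assumes "has_simple_pole_residue X t A"
  shows "mat_holomorphic_at (\<lambda>z. M ** X z) t \<longleftrightarrow> M ** A = 0"
proof -
  let ?K = "\<lambda>z. X z - scale_mat (1 / (z - t)) A"
  have K: "mat_holomorphic_at (\<lambda>z. M ** ?K z) t"
    using assms by (intro mat_holomorphic_at_mult mat_holomorphic_at_const)
      (simp add: has_simple_pole_residue_iff)
  have eq: "M ** ?K z = M ** X z - scale_mat (1 / (z - t)) (M ** A)" for z
    by (simp add: matrix_diff_ldistrib scale_mat_mult_right)
  show ?thesis
  proof
    assume "mat_holomorphic_at (\<lambda>z. M ** X z) t"
    from mat_holomorphic_at_diff[OF this K]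
    have "mat_holomorphic_at (\<lambda>z. scale_mat (1 / (z - t)) (M ** A)) t" unfolding eq by simp
    then show "M ** A = 0" by (rule mat_holomorphic_at_principal_part_zero)
  qed (use K[unfolded eq] in simp)
qed

lemma mat_holomorphic_at_scale_simple_pole:
  assumes "has_simple_pole_residue X t A"
  shows "mat_holomorphic_at (\<lambda>z. scale_mat (z - t) (X z)) t"
proof -
  have "mat_holomorphic_at (\<lambda>z. scale_mat (z - t) (mat 1)) t"
    by (rule mat_holomorphic_on_imp_at[of _ UNIV])
      (auto intro!: mat_holomorphic_on_scale mat_holomorphic_on_const holomorphic_intros)
  from mat_holomorphic_at_mult[OF this assms[unfolded has_simple_pole_residue_iff]]
  have "mat_holomorphic_at
      (\<lambda>z. scale_mat (z - t) (mat 1) ** (X z - scale_mat (1 / (z - t)) A) + A) t"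
    by (rule mat_holomorphic_at_add[OF _ mat_holomorphic_at_const])
  then show ?thesis
    by (rule mat_holomorphic_at_cong)
      (auto simp: eventually_at_topological matrix_diff_ldistrib scale_mat_mult_left
        scale_mat_scale_mat intro!: exI[of _ UNIV])
qed

text \<open>With \<open>X = A / (z - t) + H\<close>, the relation \<open>X Y = I\<close> reads \<open>A Y / (z - t) = I - H Y\<close>. So \<open>A Y\<close>
  vanishes at \<open>t\<close>, in the form in which it is used: division by \<open>z - t\<close> does no harm.\<close>

lemma mat_holomorphic_at_residue_mult_inverse:
  assumes X: "has_simple_pole_residue X t A" and Y: "mat_holomorphic_at Y t"
    and XY: "\<forall>\<^sub>F z in at t. X z ** Y z = mat 1"
  shows "mat_holomorphic_at (\<lambda>z. scale_mat (1 / (z - t)) (A ** Y z)) t"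
proof -
  have "mat_holomorphic_at (\<lambda>z. mat 1 - (X z - scale_mat (1 / (z - t)) A) ** Y z) t"
    by (rule mat_holomorphic_at_diff[OF mat_holomorphic_at_const mat_holomorphic_at_mult])
      (use X Y in \<open>simp_all add: has_simple_pole_residue_iff\<close>)
  then show ?thesis
    by (rule mat_holomorphic_at_cong)
      (use XY in eventually_elim, simp add: matrix_diff_rdistrib scale_mat_mult_left)
qed

lemma mat_holomorphic_at_inverse_mult_residue:
  assumes X: "has_simple_pole_residue X t A" and Y: "mat_holomorphic_at Y t"
    and YX: "\<forall>\<^sub>F z in at t. Y z ** X z = mat 1"
  shows "mat_holomorphic_at (\<lambda>z. scale_mat (1 / (z - t)) (Y z ** A)) t"
proof -
  have "mat_holomorphic_at (\<lambda>z. mat 1 - Y z ** (X z - scale_mat (1 / (z - t)) A)) t"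
    by (rule mat_holomorphic_at_diff[OF mat_holomorphic_at_const mat_holomorphic_at_mult])
      (use X Y in \<open>simp_all add: has_simple_pole_residue_iff\<close>)
  then show ?thesis
    by (rule mat_holomorphic_at_cong)
      (use YX in eventually_elim, simp add: matrix_diff_ldistrib scale_mat_mult_right)
qed

section \<open>Elementary factors and local factorizations\<close>

text \<open>For a projection \<open>P\<close> this is the operator acting as \<open>c\<close> on the image of \<open>P\<close> and as the
  identity on its kernel, so \<open>c \<mapsto> (I - P) + c P\<close> is multiplicative. Its values at \<open>c = 1/\<zeta>\<close> and \<open>c = \<zeta>\<close> are
  the models of a rank one simple pole and a rank one simple zero.\<close>

definition elementary_factor :: "complex^'m^'m \<Rightarrow> complex \<Rightarrow> complex^'m^'m" where
  "elementary_factor P c = (mat 1 - P) + scale_mat c P"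

lemma elementary_factor_mult:
  assumes "P ** P = P"
  shows "elementary_factor P c ** elementary_factor P d = elementary_factor P (c * d)"
  unfolding elementary_factor_def
  by (simp add: matrix_add_ldistrib matrix_add_rdistrib matrix_diff_ldistrib matrix_diff_rdistrib
      scale_mat_mult_left scale_mat_mult_right scale_mat_scale_mat assms mult.commute)

lemma elementary_factor_one: "elementary_factor P 1 = mat 1"
  by (simp add: elementary_factor_def)

lemma invertible_elementary_factor:
  assumes "P ** P = P" "c \<noteq> 0"
  shows "invertible (elementary_factor P c)"
  unfolding invertible_right_inverse
  using assms by (intro exI[of _ "elementary_factor P (1 / c)"])
    (simp add: elementary_factor_mult elementary_factor_one)

lemma mat_holomorphic_on_elementary_factor:
  assumes "c holomorphic_on S"
  shows "mat_holomorphic_on (\<lambda>z. elementary_factor P (c z)) S"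
  unfolding elementary_factor_def
  by (intro mat_holomorphic_on_add mat_holomorphic_on_scale mat_holomorphic_on_const assms)

text \<open>The condition imposed on \<open>R\<close> at one singular point in the notion of an isoprincipal family:
  \<open>E\<close> carries the whole singularity of \<open>X\<close> at \<open>t\<close>, in the local coordinate \<open>\<zeta> = z - t\<close>.\<close>

definition locally_factors ::
    "(complex \<Rightarrow> complex^'m^'m) \<Rightarrow> complex \<Rightarrow> (complex \<Rightarrow> complex^'m^'m) \<Rightarrow> bool" where
  "locally_factors X t E \<longleftrightarrow>
     (\<exists>H S. open S \<and> t \<in> S \<and> mat_holomorphic_on H S \<and> (\<forall>z\<in>S. invertible (H z)) \<and>
        (\<forall>z\<in>S - {t}. X z = H z ** E (z - t)))"

text \<open>Here \<open>E(\<zeta>) = (I - P) + c(\<zeta>) P\<close>, and the two holomorphy hypotheses concern \<open>X E\<^sup>-\<^sup>1\<close> and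
  \<open>E Y = (X E\<^sup>-\<^sup>1)\<^sup>-\<^sup>1\<close>. Both extend over \<open>t\<close>, so \<open>X E\<^sup>-\<^sup>1\<close> extends to an invertible matrix
  function.\<close>

lemma elementary_factorization:
  assumes P: "P ** P = P" and c: "\<And>z. z \<noteq> 0 \<Longrightarrow> c z \<noteq> 0"
    and XY: "\<forall>\<^sub>F z in at t. X z ** Y z = mat 1"
    and U: "mat_holomorphic_at (\<lambda>z. X z ** elementary_factor P (1 / c (z - t))) t"
    and V: "mat_holomorphic_at (\<lambda>z. elementary_factor P (c (z - t)) ** Y z) t"
  shows "locally_factors X t (\<lambda>\<zeta>. elementary_factor P (c \<zeta>))"
proof -
  have ne: "\<forall>\<^sub>F z in at t. z \<noteq> t" by (simp add: eventually_at_filter)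
  have unit: "\<forall>\<^sub>F z in at t. (X z ** elementary_factor P (1 / c (z - t))) ** (elementary_factor P (c (z - t)) ** Y z) = mat 1"
    using XY ne
  proof eventually_elim
    case (elim z)
    have "(X z ** elementary_factor P (1 / c (z - t))) ** (elementary_factor P (c (z - t)) ** Y z)
      = X z ** (elementary_factor P (1 / c (z - t)) ** elementary_factor P (c (z - t))) ** Y z"
      by (simp add: matrix_mul_assoc)
    then show ?case using elim c[of "z - t"] by (simp add: elementary_factor_mult[OF P] elementary_factor_one)
  qed
  obtain H S where H: "open S" "t \<in> S" "mat_holomorphic_on H S"
    "\<And>z. z \<in> S \<Longrightarrow> invertible (H z)"
    "\<And>z. z \<in> S \<Longrightarrow> z \<noteq> t \<Longrightarrow> X z ** elementary_factor P (1 / c (z - t)) = H z"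
    by (rule mat_holomorphic_at_unit[OF U V unit], rule that)
  have "X z = H z ** elementary_factor P (c (z - t))" if "z \<in> S - {t}" for z
  proof -
    have "H z ** elementary_factor P (c (z - t))
        = X z ** (elementary_factor P (1 / c (z - t)) ** elementary_factor P (c (z - t)))"
      using H(5)[of z] that by (simp add: matrix_mul_assoc)
    then show ?thesis using c[of "z - t"] that by (simp add: elementary_factor_mult[OF P] elementary_factor_one)
  qed
  then show ?thesis unfolding locally_factors_def using H by (intro exI[of _ H] exI[of _ S]) auto
qed

text \<open>With \<open>P = h g\<close>: in \<open>X E\<^sup>-\<^sup>1 = X (I - P) + (z - t) X P\<close> the first summand has residue
  \<open>f g (I - P) = 0\<close>. In \<open>E Y = (I - P) Y + P Y / (z - t)\<close> the second summand is holomorphic because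
  \<open>f g Y / (z - t)\<close> is, and \<open>P = (h l) (f g)\<close> for any row \<open>l\<close> with \<open>l f = 1\<close>. The factor thus
  depends only on the row \<open>g\<close> and on \<open>h\<close>, but not on \<open>f\<close>.\<close>

lemma factorization_at_pole:
  assumes X: "has_simple_pole_residue X t (outer f g)" and "f \<noteq> 0"
    and gh: "(\<Sum>i\<in>UNIV. g $ i * h $ i) = 1"
    and Y: "mat_holomorphic_at Y t" and XY: "\<forall>\<^sub>F z in at t. X z ** Y z = mat 1"
  shows "locally_factors X t (\<lambda>\<zeta>. elementary_factor (outer h g) (1 / \<zeta>))"
proof (rule elementary_factorization[OF _ _ XY])
  let ?P = "outer h g"
  show "?P ** ?P = ?P" by (rule outer_mult_outer[OF gh])
  have "outer f g ** (mat 1 - ?P) = 0"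
    by (simp add: matrix_diff_ldistrib outer_mult_outer[OF gh])
  then have "mat_holomorphic_at (\<lambda>z. X z ** (mat 1 - ?P)) t"
    by (simp add: simple_pole_mult_right_iff[OF X])
  moreover have "mat_holomorphic_at (\<lambda>z. scale_mat (z - t) (X z) ** ?P) t"
    by (intro mat_holomorphic_at_mult mat_holomorphic_at_const
        mat_holomorphic_at_scale_simple_pole[OF X])
  ultimately have "mat_holomorphic_at (\<lambda>z. X z ** (mat 1 - ?P) + scale_mat (z - t) (X z) ** ?P) t"
    by (rule mat_holomorphic_at_add)
  then show "mat_holomorphic_at (\<lambda>z. X z ** elementary_factor ?P (1 / (1 / (z - t)))) t"
    by (simp add: elementary_factor_def matrix_add_ldistrib scale_mat_mult_left scale_mat_mult_right)
  obtain l where l: "(\<Sum>i\<in>UNIV. l $ i * f $ i) = 1"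
    using exists_dual_vector[OF \<open>f \<noteq> 0\<close>] by metis
  have "mat_holomorphic_at (\<lambda>z. outer h l ** scale_mat (1 / (z - t)) (outer f g ** Y z)) t"
    by (intro mat_holomorphic_at_mult mat_holomorphic_at_const
        mat_holomorphic_at_residue_mult_inverse[OF X Y XY])
  then have "mat_holomorphic_at (\<lambda>z. scale_mat (1 / (z - t)) (?P ** Y z)) t"
    by (simp add: scale_mat_mult_right matrix_mul_assoc outer_mult_outer[OF l])
  then have "mat_holomorphic_at (\<lambda>z. (mat 1 - ?P) ** Y z + scale_mat (1 / (z - t)) (?P ** Y z)) t"
    by (intro mat_holomorphic_at_add mat_holomorphic_at_mult mat_holomorphic_at_const Y)
  then show "mat_holomorphic_at (\<lambda>z. elementary_factor ?P (1 / (z - t)) ** Y z) t"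
    by (simp add: elementary_factor_def matrix_add_rdistrib scale_mat_mult_left)
qed simp

text \<open>The mirror image of the factorization at a pole: now the residue \<open>f g\<close> belongs to the inverse
  \<open>Y\<close>, the projection is \<open>P = f l\<close>, and the exponent of \<open>\<zeta>\<close> in the factor changes sign. Since
  \<open>E = (I - P) + \<zeta> P\<close> stands to the left of \<open>Y\<close>, it is the column \<open>f\<close> that has to be kept.\<close>

lemma factorization_at_zero:
  assumes Y: "has_simple_pole_residue Y t (outer f g)" and "g \<noteq> 0"
    and lf: "(\<Sum>i\<in>UNIV. l $ i * f $ i) = 1"
    and X: "mat_holomorphic_at X t" and XY: "\<forall>\<^sub>F z in at t. X z ** Y z = mat 1"
  shows "locally_factors X t (elementary_factor (outer f l))"
proof (rule elementary_factorization[OF _ _ XY])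
  let ?P = "outer f l"
  show "?P ** ?P = ?P" by (rule outer_mult_outer[OF lf])
  have "(mat 1 - ?P) ** outer f g = 0"
    by (simp add: matrix_diff_rdistrib outer_mult_outer[OF lf])
  then have "mat_holomorphic_at (\<lambda>z. (mat 1 - ?P) ** Y z) t"
    by (simp add: simple_pole_mult_left_iff[OF Y])
  moreover have "mat_holomorphic_at (\<lambda>z. ?P ** scale_mat (z - t) (Y z)) t"
    by (intro mat_holomorphic_at_mult mat_holomorphic_at_const
        mat_holomorphic_at_scale_simple_pole[OF Y])
  ultimately have "mat_holomorphic_at (\<lambda>z. (mat 1 - ?P) ** Y z + ?P ** scale_mat (z - t) (Y z)) t"
    by (rule mat_holomorphic_at_add)
  then show "mat_holomorphic_at (\<lambda>z. elementary_factor ?P (z - t) ** Y z) t"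
    by (simp add: elementary_factor_def matrix_add_rdistrib scale_mat_mult_left scale_mat_mult_right)
  obtain h where h: "(\<Sum>i\<in>UNIV. g $ i * h $ i) = 1"
    using exists_dual_vector[OF \<open>g \<noteq> 0\<close>] by metis
  have "mat_holomorphic_at (\<lambda>z. scale_mat (1 / (z - t)) (X z ** outer f g) ** outer h l) t"
    by (intro mat_holomorphic_at_mult mat_holomorphic_at_const
        mat_holomorphic_at_inverse_mult_residue[OF Y X XY])
  then have "mat_holomorphic_at (\<lambda>z. scale_mat (1 / (z - t)) (X z ** ?P)) t"
    by (simp add: scale_mat_mult_left matrix_mul_assoc[symmetric] outer_mult_outer[OF h])
  then have "mat_holomorphic_at (\<lambda>z. X z ** (mat 1 - ?P) + scale_mat (1 / (z - t)) (X z ** ?P)) t"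
    by (intro mat_holomorphic_at_add mat_holomorphic_at_mult mat_holomorphic_at_const X)
  then show "mat_holomorphic_at (\<lambda>z. X z ** elementary_factor ?P (1 / (z - t))) t"
    by (simp add: elementary_factor_def matrix_add_ldistrib scale_mat_mult_right)
qed simp

section \<open>Generic invertibility of rational matrix functions\<close>

text \<open>The fraction need not be reduced, and the value of \<open>f\<close> at the roots of the denominator is
  arbitrary; this weak form is closed under sums and products, hence under determinants.\<close>

definition rational_off_roots :: "(complex \<Rightarrow> complex) \<Rightarrow> bool" where
  "rational_off_roots f \<longleftrightarrow> (\<exists>p q. q \<noteq> 0 \<and> (\<forall>z. poly q z \<noteq> 0 \<longrightarrow> f z = poly p z / poly q z))"

lemma rational_off_roots_const: "rational_off_roots (\<lambda>z. c)"
  unfolding rational_off_roots_def by (intro exI[of _ "[:c:]"] exI[of _ 1]) simp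

lemma rational_off_roots_add:
  assumes "rational_off_roots f" "rational_off_roots g"
  shows "rational_off_roots (\<lambda>z. f z + g z)"
proof -
  obtain p q r s where "q \<noteq> 0" "\<And>z. poly q z \<noteq> 0 \<Longrightarrow> f z = poly p z / poly q z"
    "s \<noteq> 0" "\<And>z. poly s z \<noteq> 0 \<Longrightarrow> g z = poly r z / poly s z"
    using assms unfolding rational_off_roots_def by metis
  then show ?thesis unfolding rational_off_roots_def
    by (intro exI[of _ "p * s + r * q"] exI[of _ "q * s"]) (auto simp: field_simps)
qed

lemma rational_off_roots_mult:
  assumes "rational_off_roots f" "rational_off_roots g"
  shows "rational_off_roots (\<lambda>z. f z * g z)"
proof -
  obtain p q r s where "q \<noteq> 0" "\<And>z. poly q z \<noteq> 0 \<Longrightarrow> f z = poly p z / poly q z"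
    "s \<noteq> 0" "\<And>z. poly s z \<noteq> 0 \<Longrightarrow> g z = poly r z / poly s z"
    using assms unfolding rational_off_roots_def by metis
  then show ?thesis unfolding rational_off_roots_def
    by (intro exI[of _ "p * r"] exI[of _ "q * s"]) auto
qed

lemma rational_off_roots_sum:
  "(\<And>i. i \<in> I \<Longrightarrow> rational_off_roots (f i)) \<Longrightarrow> rational_off_roots (\<lambda>z. \<Sum>i\<in>I. f i z)"
  by (induction I rule: infinite_finite_induct)
    (auto intro: rational_off_roots_add rational_off_roots_const)

lemma rational_off_roots_prod:
  "(\<And>i. i \<in> I \<Longrightarrow> rational_off_roots (f i)) \<Longrightarrow> rational_off_roots (\<lambda>z. \<Prod>i\<in>I. f i z)"
  by (induction I rule: infinite_finite_induct)
    (auto intro: rational_off_roots_mult rational_off_roots_const)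

lemma rational_off_roots_finite_zeros:
  assumes "rational_off_roots f" "infinite {z. f z \<noteq> 0}"
  shows "finite {z. f z = 0}"
proof -
  obtain p q where q: "q \<noteq> 0" and f: "\<And>z. poly q z \<noteq> 0 \<Longrightarrow> f z = poly p z / poly q z"
    using assms unfolding rational_off_roots_def by metis
  have "p \<noteq> 0"
  proof
    assume "p = 0"
    then have "{z. f z \<noteq> 0} \<subseteq> {z. poly q z = 0}" using f by auto
    then show False using assms(2) poly_roots_finite[OF q] finite_subset by blast
  qed
  have "{z. f z = 0} \<subseteq> {z. poly p z = 0} \<union> {z. poly q z = 0}" using f by fastforce
  then show ?thesis
    using poly_roots_finite[OF q] poly_roots_finite[OF \<open>p \<noteq> 0\<close>] finite_subset by blast
qed

text \<open>This is what makes \<open>mat_inverse_fun R\<close> meaningful near every point, singular or not.\<close>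

lemma generic_rational_eventually_invertible:
  assumes "generic_rational R"
  shows "\<forall>\<^sub>F z in at t. invertible (R z)"
proof -
  have "rational_off_roots (\<lambda>z. R z $ i $ j)" for i j
    using assms unfolding generic_rational_def rational_matrix_function_def rational_off_roots_def
    by metis
  then have "rational_off_roots (\<lambda>z. det (R z))"
    unfolding det_def
    by (intro rational_off_roots_sum rational_off_roots_mult rational_off_roots_prod
        rational_off_roots_const)
  then have "finite {z. det (R z) = 0}"
    using assms by (intro rational_off_roots_finite_zeros) (simp_all add: generic_rational_def)
  then have "\<not> t islimpt {z. det (R z) = 0}" by (rule islimpt_finite)
  then show ?thesis by (simp add: islimpt_iff_eventually invertible_det_nz)
qed

lemma generic_rational_eventually_inverse:
  assumes "generic_rational R"
  shows "\<forall>\<^sub>F z in at t. R z ** mat_inverse_fun R z = mat 1"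
    "\<forall>\<^sub>F z in at t. mat_inverse_fun R z ** R z = mat 1"
  by (rule eventually_mono[OF generic_rational_eventually_invertible[OF assms]],
      simp add: mat_inverse_fun_def matrix_inv_cancel)+

section \<open>Transfer of semiresidual factors between parameter values\<close>

lemma locally_factorsE:
  assumes "locally_factors X t E"
  obtains H K where "mat_holomorphic_at H t" "mat_holomorphic_at K t"
    "\<forall>\<^sub>F z in at t. H z ** K z = mat 1 \<and> K z ** H z = mat 1 \<and> X z = H z ** E (z - t)"
proof -
  obtain H S where H: "open S" "t \<in> S" "mat_holomorphic_on H S" "\<And>z. z \<in> S \<Longrightarrow> invertible (H z)"
    "\<And>z. z \<in> S \<Longrightarrow> z \<noteq> t \<Longrightarrow> X z = H z ** E (z - t)"
    using assms unfolding locally_factors_def by auto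
  show thesis
  proof
    show "mat_holomorphic_at H t" by (rule mat_holomorphic_on_imp_at[OF H(3,1,2)])
    show "mat_holomorphic_at (\<lambda>z. matrix_inv (H z)) t"
      by (rule mat_holomorphic_on_imp_at[OF mat_holomorphic_on_matrix_inv[OF H(3,4)] H(1,2)])
    show "\<forall>\<^sub>F z in at t. H z ** matrix_inv (H z) = mat 1 \<and> matrix_inv (H z) ** H z = mat 1 \<and>
        X z = H z ** E (z - t)"
      unfolding eventually_at_topological
      using H by (intro exI[of _ S]) (simp add: matrix_inv_cancel)
  qed
qed

text \<open>The holomorphy of \<open>X (I - h g)\<close> at \<open>s\<close> is inherited by \<open>E (I - h g) = H\<^sup>-\<^sup>1 X (I - h g)\<close> at \<open>0\<close>
  and from there by \<open>X' (I - h g) = H' E (I - h g)\<close> at \<open>s'\<close>.\<close>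

lemma residue_row_transfer:
  assumes X: "has_simple_pole_residue X s (outer f g)" and "g \<noteq> 0"
    and X': "has_simple_pole_residue X' s' A'"
    and E: "locally_factors X s E" and E': "locally_factors X' s' E"
  shows "\<exists>f'. A' = outer f' g"
proof -
  obtain h where gh: "(\<Sum>i\<in>UNIV. g $ i * h $ i) = 1"
    using exists_dual_vector[OF \<open>g \<noteq> 0\<close>] by metis
  let ?Q = "mat 1 - outer h g"
  obtain H K where "mat_holomorphic_at H s" and K: "mat_holomorphic_at K s"
    and HK: "\<forall>\<^sub>F z in at s. H z ** K z = mat 1 \<and> K z ** H z = mat 1 \<and> X z = H z ** E (z - s)"
    by (rule locally_factorsE[OF E], rule that)
  obtain H' K' where H': "mat_holomorphic_at H' s'" and "mat_holomorphic_at K' s'"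
    and HK': "\<forall>\<^sub>F z in at s'. H' z ** K' z = mat 1 \<and> K' z ** H' z = mat 1 \<and> X' z = H' z ** E (z - s')"
    by (rule locally_factorsE[OF E'], rule that)
  have "outer f g ** ?Q = 0"
    by (simp add: matrix_diff_ldistrib outer_mult_outer[OF gh])
  then have "mat_holomorphic_at (\<lambda>z. X z ** ?Q) s"
    by (rule simple_pole_mult_right_iff[OF X, THEN iffD2])
  from mat_holomorphic_at_mult[OF K this]
  have "mat_holomorphic_at (\<lambda>z. E (z - s) ** ?Q) s"
    by (rule mat_holomorphic_at_cong) (use HK in eventually_elim, simp add: matrix_mul_assoc)
  from mat_holomorphic_at_shift[OF this, of s']
  have "mat_holomorphic_at (\<lambda>z. E (z - s') ** ?Q) s'" by (simp add: algebra_simps)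
  from mat_holomorphic_at_mult[OF H' this]
  have "mat_holomorphic_at (\<lambda>z. X' z ** ?Q) s'"
    by (rule mat_holomorphic_at_cong) (use HK' in eventually_elim, simp add: matrix_mul_assoc)
  then have "A' ** ?Q = 0"
    by (rule simple_pole_mult_right_iff[OF X', THEN iffD1])
  then have "A' = A' ** outer h g"
    by (simp add: matrix_diff_ldistrib)
  then show ?thesis by (auto simp: matrix_mult_outer)
qed

text \<open>As for rows, but applied to the inverses \<open>Y = E\<^sup>-\<^sup>1 H\<^sup>-\<^sup>1\<close>: the holomorphic invertible factor now
  stands on the right, so it is a left factor \<open>I - f l\<close> that can be carried from \<open>Y\<close> to \<open>E\<^sup>-\<^sup>1\<close>
  and on to \<open>Y'\<close>.\<close>

lemma residue_column_transfer:
  assumes Y: "has_simple_pole_residue Y s (outer f g)" and "f \<noteq> 0"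
    and Y': "has_simple_pole_residue Y' s' A'"
    and E: "locally_factors X s E" and E': "locally_factors X' s' E"
    and inv: "\<And>\<zeta>. \<zeta> \<noteq> 0 \<Longrightarrow> invertible (E \<zeta>)"
    and YX: "\<forall>\<^sub>F z in at s. Y z ** X z = mat 1"
    and YX': "\<forall>\<^sub>F z in at s'. Y' z ** X' z = mat 1"
  shows "\<exists>g'. A' = outer f g'"
proof -
  obtain l where lf: "(\<Sum>i\<in>UNIV. l $ i * f $ i) = 1"
    using exists_dual_vector[OF \<open>f \<noteq> 0\<close>] by metis
  let ?Q = "mat 1 - outer f l"
  let ?W = "\<lambda>\<zeta>. matrix_inv (E \<zeta>)"
  have W: "E (z - t) ** ?W (z - t) = mat 1" if "z \<noteq> t" for z t
    using matrix_inv_cancel[OF inv] that by simp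
  have ne: "\<forall>\<^sub>F z in at t. z \<noteq> t" for t :: complex by (simp add: eventually_at_filter)
  obtain H K where H: "mat_holomorphic_at H s" and "mat_holomorphic_at K s"
    and HK: "\<forall>\<^sub>F z in at s. H z ** K z = mat 1 \<and> K z ** H z = mat 1 \<and> X z = H z ** E (z - s)"
    by (rule locally_factorsE[OF E], rule that)
  obtain H' K' where "mat_holomorphic_at H' s'" and K': "mat_holomorphic_at K' s'"
    and HK': "\<forall>\<^sub>F z in at s'. H' z ** K' z = mat 1 \<and> K' z ** H' z = mat 1 \<and> X' z = H' z ** E (z - s')"
    by (rule locally_factorsE[OF E'], rule that)
  have "?Q ** outer f g = 0"
    by (simp add: matrix_diff_rdistrib outer_mult_outer[OF lf])
  then have "mat_holomorphic_at (\<lambda>z. ?Q ** Y z) s"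
    by (rule simple_pole_mult_left_iff[OF Y, THEN iffD2])
  from mat_holomorphic_at_mult[OF this H]
  have "mat_holomorphic_at (\<lambda>z. ?Q ** ?W (z - s)) s"
  proof (rule mat_holomorphic_at_cong)
    show "\<forall>\<^sub>F z in at s. ?Q ** Y z ** H z = ?Q ** ?W (z - s)"
      using HK YX ne[of s]
    proof eventually_elim
      case (elim z)
      have "Y z ** H z = Y z ** H z ** (E (z - s) ** ?W (z - s))" using W elim by simp
      also have "\<dots> = Y z ** (H z ** E (z - s)) ** ?W (z - s)" by (simp only: matrix_mul_assoc)
      also have "\<dots> = ?W (z - s)" using elim by simp
      finally show ?case by (simp add: matrix_mul_assoc[symmetric])
    qed
  qed
  from mat_holomorphic_at_shift[OF this, of s']
  have "mat_holomorphic_at (\<lambda>z. ?Q ** ?W (z - s')) s'" by (simp add: algebra_simps)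
  from mat_holomorphic_at_mult[OF this K']
  have "mat_holomorphic_at (\<lambda>z. ?Q ** Y' z) s'"
  proof (rule mat_holomorphic_at_cong)
    show "\<forall>\<^sub>F z in at s'. ?Q ** ?W (z - s') ** K' z = ?Q ** Y' z"
      using HK' YX' ne[of s']
    proof eventually_elim
      case (elim z)
      have "?W (z - s') ** K' z = Y' z ** (H' z ** E (z - s')) ** ?W (z - s') ** K' z"
        using elim by simp
      also have "\<dots> = Y' z ** H' z ** (E (z - s') ** ?W (z - s')) ** K' z"
        by (simp only: matrix_mul_assoc)
      also have "\<dots> = Y' z ** H' z ** K' z" using W elim by simp
      also have "\<dots> = Y' z ** (H' z ** K' z)" by (simp only: matrix_mul_assoc)
      also have "\<dots> = Y' z" using elim by simp
      finally show ?case by (simp add: matrix_mul_assoc[symmetric])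
    qed
  qed
  then have "?Q ** A' = 0"
    by (rule simple_pole_mult_left_iff[OF Y', THEN iffD1])
  then have "A' = outer f l ** A'"
    by (simp add: matrix_diff_rdistrib)
  then show ?thesis by (auto simp: outer_mult_matrix)
qed

section \<open>Isoprincipal and isosemiresidual families\<close>

lemma left_semiresidual_iff:
  "left_semiresidual X s F \<longleftrightarrow> (\<forall>k. \<exists>g. has_simple_pole_residue X (s k) (outer (column k F) g))"
proof
  assume "\<forall>k. \<exists>g. has_simple_pole_residue X (s k) (outer (column k F) g)"
  then obtain g where "\<And>k. has_simple_pole_residue X (s k) (outer (column k F) (g k))" by metis
  then show "left_semiresidual X s F"
    unfolding left_semiresidual_def outer_def column_def
    by (intro exI[of _ "\<chi> k. g k"]) simp
qed (auto simp: left_semiresidual_def outer_def column_def)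

lemma right_semiresidual_iff:
  "right_semiresidual X s G \<longleftrightarrow> (\<forall>k. \<exists>f. has_simple_pole_residue X (s k) (outer f (row k G)))"
proof
  assume "\<forall>k. \<exists>f. has_simple_pole_residue X (s k) (outer f (row k G))"
  then obtain f where "\<And>k. has_simple_pole_residue X (s k) (outer (f k) (row k G))" by metis
  then show "right_semiresidual X s G"
    unfolding right_semiresidual_def outer_def row_def
    by (intro exI[of _ "\<chi> i k. f k $ i"]) simp
next
  assume "right_semiresidual X s G"
  then obtain F where
    "\<And>k. has_simple_pole_residue X (s k) (\<chi> i j. F $ i $ k * G $ k $ j)"
    unfolding right_semiresidual_def by metis
  then have "has_simple_pole_residue X (s k) (outer (column k F) (row k G))" for k
    by (simp add: outer_def column_def row_def)
  then show "\<forall>k. \<exists>f. has_simple_pole_residue X (s k) (outer f (row k G))" by metis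
qed

lemma isoprincipal_iff:
  "isoprincipal D R \<longleftrightarrow>
     (\<forall>k. \<exists>E. mat_holomorphic_on E (- {0}) \<and> (\<forall>\<zeta>. \<zeta> \<noteq> 0 \<longrightarrow> invertible (E \<zeta>)) \<and>
        (\<forall>t\<in>D. locally_factors (\<lambda>z. R z t) (t $ k) E))"
  unfolding isoprincipal_def locally_factors_def ..

theorem theorem17p2:
  fixes D :: "(complex^('n::finite + 'n)) set"
    and R :: "complex \<Rightarrow> complex^('n + 'n) \<Rightarrow> complex^'m::finite^'m"
  assumes "complex_domain D"
    and "D \<subseteq> distinct_coords"
    and "normalized_holomorphic_family D R"
  shows "isoprincipal D R \<longleftrightarrow> PZ_isosemiresidual D R"
proof -
  let ?R = "\<lambda>t z. R z t"
  let ?Y = "\<lambda>t. mat_inverse_fun (?R t)"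
  obtain t0 where t0: "t0 \<in> D" using assms(1) by (auto simp: complex_domain_def)
  have gen: "generic_rational (?R t)" if "t \<in> D" for t
    using assms(3) that by (simp add: normalized_holomorphic_family_def)
  note inv = generic_rational_eventually_inverse[OF gen]
  have pole: "pole_point (?R t) (t $ Inl k)" if "t \<in> D" for t k
    using assms(3) that
    unfolding normalized_holomorphic_family_def bij_betw_def pole_locus_def by blast
  have zero: "zero_point (?R t) (t $ Inr k)" if "t \<in> D" for t k
    using assms(3) that
    unfolding normalized_holomorphic_family_def bij_betw_def zero_locus_def by blast
  have pole_rank: "rank A = 1" if "t \<in> D" "has_simple_pole_residue (?R t) (t $ Inl k) A" for t k A
    using gen[OF that(1)] pole[OF that(1), of k] that(2) unfolding generic_rational_def by blast
  have zero_rank: "rank A = 1" if "t \<in> D" "has_simple_pole_residue (?Y t) (t $ Inr k) A" for t k A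
    using gen[OF that(1)] zero[OF that(1), of k] that(2) unfolding generic_rational_def by blast
  show ?thesis
  proof
    assume "isoprincipal D R"
    then obtain E where
      E_inv: "\<And>k \<zeta>. \<zeta> \<noteq> 0 \<Longrightarrow> invertible (E k \<zeta>)"
      and E: "\<And>k t. t \<in> D \<Longrightarrow> locally_factors (?R t) (t $ k) (E k)"
      unfolding isoprincipal_iff by metis
    have "\<exists>g. \<forall>t\<in>D. \<exists>f. has_simple_pole_residue (?R t) (t $ Inl k) (outer f g)" for k
    proof -
      obtain A0 where A0: "has_simple_pole_residue (?R t0) (t0 $ Inl k) A0"
        using pole[OF t0] unfolding pole_point_def has_simple_pole_def by blast
      \<comment> \<open>The row is read off at \<open>t0\<close>; the common factor \<open>E\<close> forces it on all other parameters.\<close>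
      obtain f g where fg: "g \<noteq> 0" "A0 = outer f g"
        using rank_one_imp_outer[OF pole_rank[OF t0 A0]] by metis
      have "\<exists>f. has_simple_pole_residue (?R t) (t $ Inl k) (outer f g)" if t: "t \<in> D" for t
      proof -
        obtain A where A: "has_simple_pole_residue (?R t) (t $ Inl k) A"
          using pole[OF t] unfolding pole_point_def has_simple_pole_def by blast
        show ?thesis
          using residue_row_transfer[OF A0[unfolded fg(2)] fg(1) A E[OF t0] E[OF t]] A by blast
      qed
      then show ?thesis by blast
    qed
    then obtain g where
      g: "\<And>t k. t \<in> D \<Longrightarrow> \<exists>f. has_simple_pole_residue (?R t) (t $ Inl k) (outer f (g k))"
      by metis
    have "\<exists>f. \<forall>t\<in>D. \<exists>g. has_simple_pole_residue (?Y t) (t $ Inr k) (outer f g)" for k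
    proof -
      obtain A0 where A0: "has_simple_pole_residue (?Y t0) (t0 $ Inr k) A0"
        using zero[OF t0] unfolding zero_point_def has_simple_pole_def by blast
      obtain f g where fg: "f \<noteq> 0" "A0 = outer f g"
        using rank_one_imp_outer[OF zero_rank[OF t0 A0]] by metis
      have "\<exists>g. has_simple_pole_residue (?Y t) (t $ Inr k) (outer f g)" if t: "t \<in> D" for t
      proof -
        obtain A where A: "has_simple_pole_residue (?Y t) (t $ Inr k) A"
          using zero[OF t] unfolding zero_point_def has_simple_pole_def by blast
        show ?thesis
          using residue_column_transfer[OF A0[unfolded fg(2)] fg(1) A E[OF t0] E[OF t] E_inv
              inv(2)[OF t0] inv(2)[OF t]] A by blast
      qed
      then show ?thesis by blast
    qed
    then obtain f where
      f: "\<And>t k. t \<in> D \<Longrightarrow> \<exists>g. has_simple_pole_residue (?Y t) (t $ Inr k) (outer (f k) g)"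
      by metis
    have "row k (\<chi> k. g k) = g k" "column k (\<chi> i k. f k $ i) = f k" for k
      by (simp_all add: row_def column_def)
    then show "PZ_isosemiresidual D R"
      unfolding PZ_isosemiresidual_def left_semiresidual_iff right_semiresidual_iff
        pole_locus_def zero_locus_def
      using f g by (intro exI[of _ "\<chi> i k. f k $ i"] exI[of _ "\<chi> k. g k"]) simp
  next
    assume "PZ_isosemiresidual D R"
    then obtain F G where
      F: "\<And>t k. t \<in> D \<Longrightarrow> \<exists>g. has_simple_pole_residue (?Y t) (t $ Inr k) (outer (column k F) g)"
      and G: "\<And>t k. t \<in> D \<Longrightarrow> \<exists>f. has_simple_pole_residue (?R t) (t $ Inl k) (outer f (row k G))"
      unfolding PZ_isosemiresidual_def left_semiresidual_iff right_semiresidual_iff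
        pole_locus_def zero_locus_def by metis
    show "isoprincipal D R"
      unfolding isoprincipal_iff
    proof
      fix k :: "'n + 'n"
      show "\<exists>E. mat_holomorphic_on E (- {0}) \<and> (\<forall>\<zeta>. \<zeta> \<noteq> 0 \<longrightarrow> invertible (E \<zeta>)) \<and>
        (\<forall>t\<in>D. locally_factors (?R t) (t $ k) E)"
      proof (cases k)
        case (Inl a)
        let ?g = "row a G"
        \<comment> \<open>\<open>E\<close> must be fixed before \<open>t\<close>, so \<open>h\<close> may depend on the constant row only.\<close>
        have "?g \<noteq> 0"
          using G[OF t0, of a] pole_rank[OF t0] rank_one_imp_nonzero by fastforce
        then obtain h where gh: "(\<Sum>i\<in>UNIV. ?g $ i * h $ i) = 1"
          using exists_dual_vector by metis
        let ?E = "\<lambda>\<zeta>. elementary_factor (outer h ?g) (1 / \<zeta>)"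
        have "locally_factors (?R t) (t $ k) ?E" if t: "t \<in> D" for t
        proof -
          obtain f where f: "has_simple_pole_residue (?R t) (t $ Inl a) (outer f ?g)"
            using G[OF t] by blast
          then have "f \<noteq> 0" using pole_rank[OF t f] rank_one_imp_nonzero by fastforce
          moreover have "mat_holomorphic_at (?Y t) (t $ Inl a)"
            using pole[OF t] by (simp add: pole_point_def)
          ultimately show ?thesis
            unfolding Inl using factorization_at_pole[OF f _ gh _ inv(1)[OF t]] by blast
        qed
        moreover have "mat_holomorphic_on ?E (- {0})"
          by (intro mat_holomorphic_on_elementary_factor holomorphic_intros) auto
        ultimately show ?thesis
          by (intro exI[of _ ?E]) (simp add: invertible_elementary_factor outer_mult_outer[OF gh])
      next
        case (Inr a)
        let ?f = "column a F"
        have "?f \<noteq> 0"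
          using F[OF t0, of a] zero_rank[OF t0] rank_one_imp_nonzero by fastforce
        then obtain l where lf: "(\<Sum>i\<in>UNIV. l $ i * ?f $ i) = 1"
          using exists_dual_vector by metis
        let ?E = "elementary_factor (outer ?f l)"
        have "locally_factors (?R t) (t $ k) ?E" if t: "t \<in> D" for t
        proof -
          obtain g where g: "has_simple_pole_residue (?Y t) (t $ Inr a) (outer ?f g)"
            using F[OF t] by blast
          then have "g \<noteq> 0" using zero_rank[OF t g] rank_one_imp_nonzero by fastforce
          moreover have "mat_holomorphic_at (?R t) (t $ Inr a)"
            using zero[OF t] by (simp add: zero_point_def)
          ultimately show ?thesis
            unfolding Inr using factorization_at_zero[OF g _ lf _ inv(1)[OF t]] by blast
        qed
        moreover have "mat_holomorphic_on ?E (- {0})"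
          by (intro mat_holomorphic_on_elementary_factor holomorphic_intros)
        ultimately show ?thesis
          by (intro exI[of _ ?E]) (simp add: invertible_elementary_factor outer_mult_outer[OF lf])
      qed
    qed
  qed
qed

end
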